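(* For non-negative integers $n,m$, $$P_{x_{12}^nx_{23}^m}(\beta)=\sum_{k=0}^{\min(n,m)}\binom{n+m-k}{m}\binom mk\beta^k=\sum_{k=0}^{\min(n,m)}\binom nk\binom mk(1+\beta)^k.$$ Moreover: - the polynomial $P_{(x_{12}x_{23}\cdots x_{n-1,n})^m}(\beta-1)$ is a symmetric polynomial in $\beta$ with non-negative coefficients; - the polynomial $P_{x_{12}^nx_{23}^m}(\beta)$ counts the number of $(n,m)$-Delannoy paths according to the number of $NE$ steps, i.e. the coefficient of $\beta^k$ is the number of $(n,m)$-Delannoy paths with exactly $k$ $NE$ steps.
   Context: For a monomial $M$ in commuting variables $x_{ij}$, $i<j$, over $\mathbb{Z}[\beta]$, a reduced polynomial of $M$ is obtained by repeatedly replacing (in any monomial) a product $x_{ij}x_{jk}$, $i<j<k$, by $x_{ik}x_{ij}+x_{jk}x_{ik}+\beta x_{ik}$, until no monomial contains such a product. $P_M(\beta)$ denotes the value of the reduced polynomial at $x_{ij}=1$ for all $i<j$ (the replacements are applied successively starting from the leftmost variables $x_{12}^{m_1}x_{23}$). An $(n,m)$-Delannoy path is a lattice path from $(0,0)$ to $(n,m)$ with steps $E=(1,0)$, $N=(0,1)$, $NE=(1,1)$. A polynomial $\sum_{i=0}^{d}a_i\beta^i$ of degree $d$ is symmetric if $a_i=a_{d-i}$. *)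

theory Defs
  imports
    "HOL-Library.Poly_Mapping"
    "HOL-Library.Product_Plus"
    "HOL-Computational_Algebra.Polynomial"
begin

text \<open>
  The ring of polynomials in commuting variables indexed by pairs \<open>(i, j)\<close>, over
  \<open>\<int>[\<beta>]\<close>: a monomial is a finitely supported exponent function, a polynomial a
  finitely supported coefficient function on monomials, and \<open>int poly\<close> plays the role
  of \<open>\<int>[\<beta>]\<close>.
\<close>

type_synonym monomial = "(nat \<times> nat) \<Rightarrow>\<^sub>0 nat"
type_synonym xpoly = "monomial \<Rightarrow>\<^sub>0 int poly"

definition X :: "nat \<Rightarrow> nat \<Rightarrow> xpoly" where
  "X i j = Poly_Mapping.single (Poly_Mapping.single (i, j) 1) 1"

definition \<beta> :: xpoly where
  "\<beta> = Poly_Mapping.single 0 [:0, 1:]"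

text \<open>
  One replacement: in the term \<open>c \<cdot> x\<^sub>i\<^sub>j x\<^sub>j\<^sub>k N\<close> of \<open>p\<close> the product \<open>x\<^sub>i\<^sub>j x\<^sub>j\<^sub>k\<close> is
  replaced. Nothing is prescribed about which term, or which product inside it, is
  chosen, so that every order of replacements, in particular leftmost first, is covered.
\<close>

inductive reduction_step :: "xpoly \<Rightarrow> xpoly \<Rightarrow> bool" where
  "reduction_step p
     (p - Poly_Mapping.single M c
        + Poly_Mapping.single N c * (X i k * X i j + X j k * X i k + \<beta> * X i k))"
  if "i < j" "j < k" "M \<in> Poly_Mapping.keys p" "c = Poly_Mapping.lookup p M"
    "M = Poly_Mapping.single (i, j) 1 + Poly_Mapping.single (j, k) 1 + N"

definition reduced :: "xpoly \<Rightarrow> bool" where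
  "reduced p \<longleftrightarrow> (\<forall>M \<in> Poly_Mapping.keys p. \<not> (\<exists>i j k. i < j \<and> j < k \<and>
     Poly_Mapping.lookup M (i, j) > 0 \<and> Poly_Mapping.lookup M (j, k) > 0))"

definition reduced_polynomial_of :: "xpoly \<Rightarrow> xpoly \<Rightarrow> bool" where
  "reduced_polynomial_of p r \<longleftrightarrow> reduction_step\<^sup>*\<^sup>* p r \<and> reduced r"

definition evaluate :: "(nat \<Rightarrow> nat \<Rightarrow> int poly) \<Rightarrow> xpoly \<Rightarrow> int poly" where
  "evaluate a p = (\<Sum>M \<in> Poly_Mapping.keys p. Poly_Mapping.lookup p M *
     (\<Prod>(i, j) \<in> Poly_Mapping.keys M. a i j ^ Poly_Mapping.lookup M (i, j)))"

definition is_reduced_value :: "xpoly \<Rightarrow> int poly \<Rightarrow> bool" where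
  "is_reduced_value p v \<longleftrightarrow> (\<exists>r. reduced_polynomial_of p r \<and> v = evaluate (\<lambda>i j. 1) r)"

text \<open>
  This is \<open>P\<^sub>M(\<beta>)\<close> for a monomial \<open>M\<close>. It is meaningful only where exactly one
  polynomial satisfies \<^const>\<open>is_reduced_value\<close>; reduced polynomials themselves depend on the
  order of the replacements.
\<close>

definition reduced_value :: "xpoly \<Rightarrow> int poly" where
  "reduced_value p = (THE v. is_reduced_value p v)"

definition symmetric_poly :: "int poly \<Rightarrow> bool" where
  "symmetric_poly p \<longleftrightarrow> (\<forall>i \<le> degree p. coeff p i = coeff p (degree p - i))"

datatype step = E | N | NE

fun step_vector :: "step \<Rightarrow> nat \<times> nat" where
  "step_vector E = (1, 0)"
| "step_vector N = (0, 1)"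
| "step_vector NE = (1, 1)"

text \<open>A path starting at \<open>(0, 0)\<close> is encoded by its sequence of steps.\<close>

definition delannoy_paths :: "nat \<Rightarrow> nat \<Rightarrow> step list set" where
  "delannoy_paths n m = {s. sum_list (map step_vector s) = (n, m)}"

end

theory Submission
  imports Defs "HOL-Analysis.Binary_Product_Measure"
begin

text \<open>
  Read a monomial as a directed multigraph with one edge \<open>i \<rightarrow> j\<close> for each factor \<open>x\<^sub>i\<^sub>j\<close>. A flow
  puts a natural number on every edge; let \<open>d\<^sub>v\<close> be the outflow minus the inflow at the vertex \<open>v\<close>,
  and let \<open>W\<^sub>M(z)\<close> be the sum of \<open>z\<close> to the power \<open>\<Sum>\<^sub>v max(d\<^sub>v, 0)\<close> over all flows. Up to a power of
  \<open>1 - z\<close> this is the Ehrhart series of the flow polytope in which every vertex is joined to a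
  source and to a sink.

  On two edges \<open>i \<rightarrow> j \<rightarrow> k\<close> that carry \<open>a\<close> and \<open>b\<close>, the common part \<open>min(a, b)\<close> can be
  rerouted along \<open>i \<rightarrow> k\<close> without changing any \<open>d\<^sub>v\<close>. The pairs with \<open>a \<ge> b\<close> become the flows on
  \<open>i \<rightarrow> k\<close>, \<open>i \<rightarrow> j\<close>, the pairs with \<open>a \<le> b\<close> the flows on \<open>i \<rightarrow> k\<close>, \<open>j \<rightarrow> k\<close>, and the pairs with
  \<open>a = b\<close>, which are counted twice, the flows on \<open>i \<rightarrow> k\<close>. Hence \<open>(1 - z)\<^bsup>|M|\<^esup> W\<^sub>M(z)\<close> satisfies the
  replacement rule with \<open>\<beta> = z - 1\<close>. If no replacement applies to \<open>M\<close>, every vertex only sends or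
  only receives, the exponent is the total flow, and the product is \<open>1\<close>. So every reduction of
  \<open>M\<close>, in whatever order, ends in a polynomial with the value \<open>P\<^sub>M(z - 1) = (1 - z)\<^bsup>|M|\<^esup> W\<^sub>M(z)\<close>:
  this is \<open>is_reduced_value_iff\<close>.

  Double counting is avoided if edges may be strict, that is, required to carry at least one unit.
  Then \<open>a \<ge> b\<close> and \<open>a < b\<close> (or \<open>a > b\<close> and \<open>a \<le> b\<close>, depending on which of the two edges is strict)
  partition the flows, both parts are again flows on graphs of the same size with weak and strict edges, and at the end a graph with \<open>s\<close> strict edges contributes
  \<open>z\<^bsup>s\<^esup>\<close>. This shows that \<open>P\<^sub>M(z - 1)\<close> has non-negative coefficients. Exchanging weak and strict
  edges throughout such a reduction gives another one, so it reverses the list of coefficients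
  (\<open>exists_h_polynomial\<close>); this is Ehrhart reciprocity. On the path with \<open>m\<close> parallel edges per
  step, removing one unit from every edge turns strict edges into weak ones and lowers the exponent
  by exactly \<open>m\<close>. The reversed polynomial is therefore \<open>z\<^bsup>m\<^esup>\<close> times the original one, which makes
  it palindromic (\<open>h_polynomial_symmetric\<close>).

  For \<open>x\<^sub>1\<^sub>2\<^bsup>n\<^esup> x\<^sub>2\<^sub>3\<^bsup>m\<^esup>\<close>, factors \<open>x\<^sub>1\<^sub>3\<close> take part in no replacement and do not influence the value,
  so the replacement rule becomes the recursion of the Delannoy polynomials. Both binomial sums
  and the number of paths satisfy the same recursion.
\<close>

section \<open>Marked multigraphs and their flow series\<close>

definition edge_vector :: "nat \<times> nat \<Rightarrow> nat \<Rightarrow> int" where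
  "edge_vector e v = of_bool (v = fst e) - of_bool (v = snd e)"

text \<open>
  A marked edge \<open>(e, s)\<close> is strict if \<open>s\<close> holds. Summing over flows edge by edge turns each edge
  into a summation operator on functions of the vector of net outflows. These operators commute,
  so a multigraph determines their product. Values in \<^typ>\<open>ennreal\<close> make all the interchanges of sums
  unconditional; finiteness comes out of the reduction for free.
\<close>

definition push ::
    "(nat \<times> nat) \<times> bool \<Rightarrow> ((nat \<Rightarrow> int) \<Rightarrow> ennreal) \<Rightarrow> (nat \<Rightarrow> int) \<Rightarrow> ennreal" where
  "push x \<phi> d =
     (\<integral>\<^sup>+ a. \<phi> (\<lambda>v. d v + int (a + of_bool (snd x)) * edge_vector (fst x) v) \<partial>count_space UNIV)"

text \<open>
  The bound \<open>b\<close> is any number that is at least every vertex in use; it makes the exponent a finite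
  sum.
\<close>

definition supply_weight :: "nat \<Rightarrow> real \<Rightarrow> (nat \<Rightarrow> int) \<Rightarrow> ennreal" where
  "supply_weight b z d = ennreal (z ^ (\<Sum>v\<le>b. nat (d v)))"

definition flow_series :: "nat \<Rightarrow> real \<Rightarrow> ((nat \<times> nat) \<times> bool) multiset \<Rightarrow> ennreal" where
  "flow_series b z K = fold_mset push (supply_weight b z) K (\<lambda>_. 0)"

lemma push_push:
  "push x (push y \<phi>) d =
     (\<integral>\<^sup>+ (p, q). \<phi> (\<lambda>v. d v + int (p + of_bool (snd x)) * edge_vector (fst x) v
        + int (q + of_bool (snd y)) * edge_vector (fst y) v) \<partial>count_space UNIV)"
  unfolding push_def by (subst nn_integral_fst_count_space[symmetric]) simp

lemma push_commute: "push x (push y \<phi>) = push y (push x \<phi>)"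
proof
  fix d
  have "push x (push y \<phi>) d =
     (\<integral>\<^sup>+ q. \<integral>\<^sup>+ p. \<phi> (\<lambda>v. d v + int (p + of_bool (snd x)) * edge_vector (fst x) v
        + int (q + of_bool (snd y)) * edge_vector (fst y) v) \<partial>count_space UNIV \<partial>count_space UNIV)"
    unfolding push_push by (subst nn_integral_snd_count_space[symmetric]) simp
  also have "\<dots> = push y (push x \<phi>) d"
    unfolding push_def by (simp add: algebra_simps)
  finally show "push x (push y \<phi>) d = push y (push x \<phi>) d" .
qed

interpretation push: comp_fun_commute push
  by standard (auto simp: fun_eq_iff push_commute)

lemma nn_integral_count_space_split:
  fixes F :: "'a \<Rightarrow> ennreal"
  assumes "inj f" "inj g" "range f \<inter> range g = {}" "range f \<union> range g = UNIV"
  shows "(\<integral>\<^sup>+ x. F x \<partial>count_space UNIV) =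
    (\<integral>\<^sup>+ x. F (f x) \<partial>count_space UNIV) + (\<integral>\<^sup>+ x. F (g x) \<partial>count_space UNIV)"
proof -
  have "F x = F x * indicator (range f) x + F x * indicator (range g) x" for x
    using assms(3,4) by (auto simp: indicator_def)
  then have "(\<integral>\<^sup>+ x. F x \<partial>count_space UNIV) =
      (\<integral>\<^sup>+ x. F x * indicator (range f) x + F x * indicator (range g) x \<partial>count_space UNIV)"
    by simp
  also have "\<dots> = (\<integral>\<^sup>+ x. F x * indicator (range f) x \<partial>count_space UNIV)
      + (\<integral>\<^sup>+ x. F x * indicator (range g) x \<partial>count_space UNIV)"
    by (rule nn_integral_add) auto
  also have "\<dots> = (\<integral>\<^sup>+ x. F x \<partial>count_space (range f)) + (\<integral>\<^sup>+ x. F x \<partial>count_space (range g))"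
    by (simp add: nn_integral_count_space_indicator)
  also have "(\<integral>\<^sup>+ x. F x \<partial>count_space (range f)) = (\<integral>\<^sup>+ x. F (f x) \<partial>count_space UNIV)"
    by (rule nn_integral_bij_count_space[symmetric]) (use assms in \<open>simp add: bij_betw_def\<close>)
  also have "(\<integral>\<^sup>+ x. F x \<partial>count_space (range g)) = (\<integral>\<^sup>+ x. F (g x) \<partial>count_space UNIV)"
    by (rule nn_integral_bij_count_space[symmetric]) (use assms in \<open>simp add: bij_betw_def\<close>)
  finally show ?thesis .
qed

text \<open>
  Rerouting the common part of the flows on \<open>i \<rightarrow> j \<rightarrow> k\<close> along \<open>i \<rightarrow> k\<close>. Pairs with equal flow on
  both edges have to go to one side, and \<open>u\<close> says which: to the first summand if the remaining edge
  \<open>i \<rightarrow> j\<close> is weak there, to the second if it is strict. The hypothesis ensures that the bounds \<open>s\<close>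
  and \<open>t\<close> on the two edges become one bound on the rerouted part. It is met by some \<open>u\<close> for all
  \<open>s\<close> and \<open>t\<close>, and it is stable under negating \<open>s\<close>, \<open>t\<close> and \<open>u\<close> together.
\<close>

lemma push_split:
  assumes "if u then t \<longrightarrow> s else s \<longrightarrow> t"
  shows "push ((i, j), s) (push ((j, k), t) \<phi>) d =
    push ((i, k), t) (push ((i, j), u) \<phi>) d + push ((i, k), s) (push ((j, k), \<not> u) \<phi>) d"
proof -
  \<comment> \<open>In terms of the amounts above the lower bounds, the flow on \<open>i \<rightarrow> j\<close> wins if it is at least
    \<open>c\<close> larger than the other, and loses if it is at least \<open>c'\<close> smaller; as \<open>c + c' = 1\<close>, exactly
    one of the two happens.\<close>
  define c :: nat where "c = of_bool u + of_bool t - of_bool s"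
  define c' :: nat where "c' = of_bool (\<not> u) + of_bool s - of_bool t"
  have c: "int c = of_bool u + of_bool t - of_bool s"
      "int c' = of_bool (\<not> u) + of_bool s - of_bool t" "c + c' = 1"
    using assms unfolding c_def c'_def by (auto split: if_splits)
  define f :: "nat \<times> nat \<Rightarrow> nat \<times> nat" where "f = (\<lambda>(p, q). (p + q + c, p))"
  define g :: "nat \<times> nat \<Rightarrow> nat \<times> nat" where "g = (\<lambda>(p, q). (p, p + q + c'))"
  define F where "F = (\<lambda>(p, q). \<phi> (\<lambda>v. d v + int (p + of_bool s) * edge_vector (i, j) v
        + int (q + of_bool t) * edge_vector (j, k) v))"
  have inj: "inj f" "inj g"
    by (auto simp: f_def g_def inj_def)
  have disj: "range f \<inter> range g = {}"
    using c(3) by (auto simp: f_def g_def)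
  have "x \<in> range f \<union> range g" for x
  proof (cases "snd x + c \<le> fst x")
    case True
    then have "x = f (snd x, fst x - snd x - c)"
      by (auto simp: f_def prod_eq_iff)
    then show ?thesis by blast
  next
    case False
    with c(3) have "x = g (fst x, snd x - fst x - c')"
      by (auto simp: g_def prod_eq_iff)
    then show ?thesis by blast
  qed
  then have un: "range f \<union> range g = UNIV" by auto
  have V: "edge_vector (i, k) v = edge_vector (i, j) v + edge_vector (j, k) v" for v
    by (simp add: edge_vector_def)
  have 1: "F (f (p, q)) = \<phi> (\<lambda>v. d v + int (p + of_bool t) * edge_vector (i, k) v
        + int (q + of_bool u) * edge_vector (i, j) v)" for p q
    unfolding f_def F_def by (simp add: c V algebra_simps)
  have 2: "F (g (p, q)) = \<phi> (\<lambda>v. d v + int (p + of_bool s) * edge_vector (i, k) v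
        + int (q + of_bool (\<not> u)) * edge_vector (j, k) v)" for p q
    unfolding g_def F_def by (simp add: c V algebra_simps)
  have "push ((i, j), s) (push ((j, k), t) \<phi>) d = (\<integral>\<^sup>+ x. F x \<partial>count_space UNIV)"
    unfolding push_push F_def by simp
  also have "\<dots> = (\<integral>\<^sup>+ x. F (f x) \<partial>count_space UNIV) + (\<integral>\<^sup>+ x. F (g x) \<partial>count_space UNIV)"
    by (rule nn_integral_count_space_split[OF inj disj un])
  also have "(\<integral>\<^sup>+ x. F (f x) \<partial>count_space UNIV) = push ((i, k), t) (push ((i, j), u) \<phi>) d"
    unfolding push_push by (rule nn_integral_cong) (simp only: 1 split_paired_all prod.case fst_conv snd_conv)
  also have "(\<integral>\<^sup>+ x. F (g x) \<partial>count_space UNIV) = push ((i, k), s) (push ((j, k), \<not> u) \<phi>) d"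
    unfolding push_push by (rule nn_integral_cong) (simp only: 2 split_paired_all prod.case fst_conv snd_conv)
  finally show ?thesis .
qed

lemma push_weak:
  "push (e, False) \<phi> d = \<phi> d + push (e, True) \<phi> d"
  unfolding push_def nn_integral_count_space_nat
  by (subst suminf_offset[of _ 1]) (auto intro: summableI simp: algebra_simps)

lemma flow_series_split:
  assumes "if u then t \<longrightarrow> s else s \<longrightarrow> t"
  shows "flow_series b z (add_mset ((i, j), s) (add_mset ((j, k), t) K)) =
    flow_series b z (add_mset ((i, k), t) (add_mset ((i, j), u) K)) +
    flow_series b z (add_mset ((i, k), s) (add_mset ((j, k), \<not> u) K))"
  unfolding flow_series_def by (simp add: push_split[OF assms])

lemma flow_series_weak:
  "flow_series b z (add_mset (e, False) K) =
     flow_series b z K + flow_series b z (add_mset (e, True) K)"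
  unfolding flow_series_def by (simp add: push_weak)

text \<open>
  The first condition is what the variables \<open>x\<^sub>i\<^sub>j\<close> with \<open>i < j\<close> provide; the second keeps all
  vertices within the range of \<^const>\<open>supply_weight\<close>.
\<close>

definition admissible :: "nat \<Rightarrow> (nat \<times> nat) multiset \<Rightarrow> bool" where
  "admissible b K \<longleftrightarrow> (\<forall>e \<in># K. fst e < snd e \<and> snd e \<le> b)"

definition alternating :: "(nat \<times> nat) multiset \<Rightarrow> bool" where
  "alternating K \<longleftrightarrow> (\<nexists>i j k. i < j \<and> j < k \<and> (i, j) \<in># K \<and> (j, k) \<in># K)"

lemma nn_integral_geometric:
  assumes "0 < z" "z < 1" "0 \<le> c"
  shows "(\<integral>\<^sup>+ a. ennreal (c * z ^ a) \<partial>count_space UNIV) = ennreal (c / (1 - z))"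
proof -
  have "(\<lambda>a. c * z ^ a) sums (c * (1 / (1 - z)))"
    using assms by (intro sums_mult geometric_sums) auto
  then have "(\<lambda>a. ennreal (c * z ^ a)) sums ennreal (c / (1 - z))"
    using assms by (subst sums_ennreal) auto
  then show ?thesis
    by (simp add: nn_integral_count_space_nat sums_iff)
qed

text \<open>
  In an alternating graph no vertex is both a tail and a head, so the exponent of a flow is the
  total flow, and the series is a product of geometric series, one for each edge.
\<close>

lemma flow_series_alternating:
  assumes z: "0 < z" "z < 1"
    and "admissible b (image_mset fst K)" "alternating (image_mset fst K)"
  shows "flow_series b z K =
    ennreal (z ^ size (filter_mset snd K) / (1 - z) ^ size K)"
proof -
  \<comment> \<open>The induction over the edges needs arbitrary starting vectors, but only those that are
    non-negative on the tails \<open>S\<close> and non-positive elsewhere: there the exponent is additive.\<close>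
  define S where "S = fst ` fst ` set_mset K"
  define good where "good = (\<lambda>d::nat \<Rightarrow> int. \<forall>v. if v \<in> S then 0 \<le> d v else d v \<le> 0)"
  have edges: "fst (fst x) \<in> S \<and> snd (fst x) \<notin> S \<and> fst (fst x) \<le> b" if "x \<in># K" for x
  proof -
    have "snd (fst x) \<noteq> fst (fst y)" if "y \<in># K" for y
    proof
      assume eq: "snd (fst x) = fst (fst y)"
      have "fst (fst x) < snd (fst x)" "snd (fst x) < snd (fst y)"
        using assms(3) that \<open>x \<in># K\<close> eq by (auto simp: admissible_def)
      moreover have "(fst (fst x), snd (fst x)) \<in># image_mset fst K"
        using \<open>x \<in># K\<close> by simp
      moreover have "(snd (fst x), snd (fst y)) \<in># image_mset fst K"
        using that eq by simp
      ultimately show False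
        using assms(4) unfolding alternating_def by blast
    qed
    moreover have "fst (fst x) \<le> b"
      using assms(3) that by (auto simp: admissible_def intro: order_trans[OF less_imp_le])
    ultimately show ?thesis
      using that unfolding S_def by blast
  qed
  have "fold_mset push (supply_weight b z) L d =
      ennreal (z ^ size (filter_mset snd L) / (1 - z) ^ size L * z ^ (\<Sum>v\<le>b. nat (d v)))"
    if "L \<subseteq># K" "good d" for L d
    using that
  proof (induction L arbitrary: d)
    case empty
    then show ?case by (simp add: supply_weight_def)
  next
    case (add x L)
    then have x: "x \<in># K" and L: "L \<subseteq># K"
      by (auto dest: mset_subset_eq_insertD)
    note ex = edges[OF x]
    let ?d = "\<lambda>a::nat. \<lambda>v. d v + int (a + of_bool (snd x)) * edge_vector (fst x) v"
    have d_at: "?d a v = (if v = fst (fst x) then d v + int (a + of_bool (snd x))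
        else if v = snd (fst x) then d v - int (a + of_bool (snd x)) else d v)" for a v
      using ex by (auto simp: edge_vector_def)
    have d_sign: "v \<in> S \<Longrightarrow> 0 \<le> d v" "v \<notin> S \<Longrightarrow> d v \<le> 0" for v
      using add.prems(2) by (auto simp: good_def dest: spec[of _ v])
    have good: "good (?d a)" for a
      unfolding good_def d_at
    proof (intro allI)
      fix v
      show "if v \<in> S
         then 0 \<le> (if v = fst (fst x) then d v + int (a + of_bool (snd x))
           else if v = snd (fst x) then d v - int (a + of_bool (snd x)) else d v)
         else (if v = fst (fst x) then d v + int (a + of_bool (snd x))
           else if v = snd (fst x) then d v - int (a + of_bool (snd x)) else d v) \<le> 0"
        using d_sign[of v] ex by (cases "v \<in> S") auto
    qed
    have "(\<Sum>v\<le>b. nat (?d a v)) = a + of_bool (snd x) + (\<Sum>v\<le>b. nat (d v))" for a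
    proof -
      have "nat (?d a v) = (if v = fst (fst x) then a + of_bool (snd x) else 0) + nat (d v)" for v
        unfolding d_at using d_sign[of v] ex by (cases "v \<in> S") (auto simp: nat_add_distrib)
      then show ?thesis
        using ex by (simp add: sum.distrib)
    qed
    then have "push x (fold_mset push (supply_weight b z) L) d =
      (\<integral>\<^sup>+ a. ennreal ((z ^ size (filter_mset snd L) / (1 - z) ^ size L
         * z ^ (of_bool (snd x) + (\<Sum>v\<le>b. nat (d v)))) * z ^ a) \<partial>count_space UNIV)"
      unfolding push_def add.IH[OF L good]
      by (intro nn_integral_cong) (simp add: power_add mult_ac)
    also have "\<dots> = ennreal (z ^ size (filter_mset snd L) / (1 - z) ^ size L
         * z ^ (of_bool (snd x) + (\<Sum>v\<le>b. nat (d v))) / (1 - z))"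
      using z by (intro nn_integral_geometric) auto
    finally show ?case
      by (simp add: power_add mult_ac divide_inverse)
  qed
  from this[of K "\<lambda>_. 0"] show ?thesis
    by (simp add: flow_series_def good_def)
qed

section \<open>The h-polynomial of a multigraph\<close>

definition eval_real :: "int poly \<Rightarrow> real \<Rightarrow> real" where
  "eval_real h z = poly (map_poly of_int h) z"

lemma eval_real_pCons: "eval_real (pCons a p) z = of_int a + z * eval_real p z"
  by (simp add: eval_real_def map_poly_pCons)

lemma eval_real_0 [simp]: "eval_real 0 z = 0"
  by (simp add: eval_real_def)

lemma eval_real_add: "eval_real (p + q) z = eval_real p z + eval_real q z"
  by (induction p q rule: poly_induct2) (simp_all add: eval_real_pCons algebra_simps)

lemma eval_real_smult: "eval_real (smult c p) z = of_int c * eval_real p z"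
  by (induction p) (simp_all add: eval_real_pCons algebra_simps)

lemma eval_real_mult: "eval_real (p * q) z = eval_real p z * eval_real q z"
  by (induction p) (simp_all add: eval_real_pCons eval_real_add eval_real_smult algebra_simps)

lemma eval_real_monom: "eval_real (monom c k) z = of_int c * z ^ k"
  by (simp add: eval_real_def map_poly_monom poly_monom)

lemma eval_real_eqI:
  assumes "\<And>z. 0 < z \<Longrightarrow> z < 1 \<Longrightarrow> eval_real p z = eval_real q z"
  shows "p = q"
proof (rule ccontr)
  assume "p \<noteq> q"
  let ?d = "p + smult (-1) q"
  have "?d \<noteq> 0" using \<open>p \<noteq> q\<close> by simp
  then have "map_poly real_of_int ?d \<noteq> 0"
    by (subst map_poly_eq_0_iff) auto
  then have "finite {z. poly (map_poly real_of_int ?d) z = 0}"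
    by (rule poly_roots_finite)
  moreover have "{0<..<1} \<subseteq> {z. poly (map_poly real_of_int ?d) z = 0}"
    using assms by (auto simp: eval_real_def[symmetric] eval_real_add eval_real_smult
        simp del: smult_minus_left)
  ultimately have "finite {0<..<1::real}"
    by (rule finite_subset[rotated])
  then show False
    using infinite_Ioo[of 0 "1::real"] by simp
qed

lemma eval_real_nonneg:
  assumes "\<And>i. 0 \<le> coeff h i" "0 \<le> z"
  shows "0 \<le> eval_real h z"
  using assms(1)
proof (induction h)
  case (pCons a p)
  have "0 \<le> a" "\<And>i. 0 \<le> coeff p i"
    using pCons.prems[of 0] pCons.prems[of "Suc i" for i] by auto
  then show ?case
    using pCons.IH assms(2) by (simp add: eval_real_pCons)
qed simp

text \<open>
  The name is that of the h-polynomial of a triangulation: the numerator of a series whose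
  denominator is \<open>(1 - z)\<close> to the number of edges. Non-negativity of the coefficients is included
  because equality in \<^typ>\<open>ennreal\<close> determines only non-negative real numbers.
\<close>

definition is_h_polynomial :: "nat \<Rightarrow> ((nat \<times> nat) \<times> bool) multiset \<Rightarrow> int poly \<Rightarrow> bool" where
  "is_h_polynomial b K h \<longleftrightarrow> (\<forall>i. 0 \<le> coeff h i) \<and>
     (\<forall>z. 0 < z \<longrightarrow> z < 1 \<longrightarrow> flow_series b z K = ennreal (eval_real h z / (1 - z) ^ size K))"

lemma is_h_polynomial_unique:
  assumes "is_h_polynomial b K h" "is_h_polynomial b K h'"
  shows "h = h'"
proof (rule eval_real_eqI)
  fix z :: real assume z: "0 < z" "z < 1"
  have "ennreal (eval_real h z / (1 - z) ^ size K) = ennreal (eval_real h' z / (1 - z) ^ size K)"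
    using assms z unfolding is_h_polynomial_def by metis
  moreover have "0 \<le> eval_real h z" "0 \<le> eval_real h' z"
    using assms z eval_real_nonneg unfolding is_h_polynomial_def by auto
  ultimately show "eval_real h z = eval_real h' z"
    using z by (simp add: divide_eq_eq)
qed

lemma is_h_polynomial_add:
  assumes "is_h_polynomial b K1 h1" "is_h_polynomial b K2 h2"
    and "size K1 = size K" "size K2 = size K"
    and "\<And>z. flow_series b z K = flow_series b z K1 + flow_series b z K2"
  shows "is_h_polynomial b K (h1 + h2)"
  unfolding is_h_polynomial_def
proof (intro conjI allI impI)
  show "0 \<le> coeff (h1 + h2) i" for i
    using assms(1,2) by (simp add: is_h_polynomial_def)
  fix z :: real assume z: "0 < z" "z < 1"
  have "0 \<le> eval_real h1 z" "0 \<le> eval_real h2 z"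
    using assms(1,2) z eval_real_nonneg unfolding is_h_polynomial_def by auto
  then show "flow_series b z K = ennreal (eval_real (h1 + h2) z / (1 - z) ^ size K)"
    using assms(1,2) z unfolding is_h_polynomial_def
    by (simp add: assms(3-5) eval_real_add add_divide_distrib flip: ennreal_plus)
qed

definition deficit :: "nat \<Rightarrow> (nat \<times> nat) multiset \<Rightarrow> nat" where
  "deficit b K = (\<Sum>e\<in>#K. b - (snd e - fst e))"

text \<open>
  Every replacement makes an edge longer or deletes it, and no edge is longer than \<open>b\<close>.
\<close>

lemma deficit_split:
  assumes "i < j" "j < k" "k \<le> b"
  shows "deficit b {#(i, k), (i, j)#} < deficit b {#(i, j), (j, k)#}"
    and "deficit b {#(i, k), (j, k)#} < deficit b {#(i, j), (j, k)#}"
    and "deficit b {#(i, k)#} < deficit b {#(i, j), (j, k)#}"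
  using assms by (auto simp: deficit_def)

lemma deficit_union: "deficit b (K + L) = deficit b K + deficit b L"
  by (simp add: deficit_def)

definition complement_strictness ::
    "((nat \<times> nat) \<times> bool) multiset \<Rightarrow> ((nat \<times> nat) \<times> bool) multiset" where
  "complement_strictness = image_mset (map_prod id Not)"

text \<open>
  By induction along the splitting of two consecutive edges. The two parts have as many edges as
  the original graph, hence the same denominator, so numerators add. Complementing strictness in
  a valid splitting gives a valid splitting of the complemented graph, so \<open>h'\<close> is built in parallel
  with \<open>h\<close>; at an alternating graph with \<open>s\<close> strict and \<open>w\<close> weak edges they are \<open>z\<^bsup>s\<^esup>\<close> and \<open>z\<^bsup>w\<^esup>\<close>,
  which are mirror images in degree \<open>s + w\<close>. A graph without strict edges has exactly one
  descendant of this kind, which gives the constant coefficient.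
\<close>

lemma exists_h_polynomial:
  assumes "admissible b (image_mset fst K)"
  shows "\<exists>h h'. is_h_polynomial b K h \<and> is_h_polynomial b (complement_strictness K) h' \<and>
    (\<forall>i > size K. coeff h i = 0 \<and> coeff h' i = 0) \<and>
    (\<forall>i \<le> size K. coeff h' i = coeff h (size K - i)) \<and>
    coeff h 0 = of_bool (\<forall>x \<in># K. \<not> snd x)"
  using assms
proof (induction "deficit b (image_mset fst K)" arbitrary: K rule: less_induct)
  case less
  show ?case
  proof (cases "alternating (image_mset fst K)")
    case True
    let ?s = "size (filter_mset snd K)" and ?w = "size (filter_mset (\<lambda>x. \<not> snd x) K)"
    let ?C = "complement_strictness K"
    have fst_C: "image_mset fst ?C = image_mset fst K"
      by (simp add: complement_strictness_def multiset.map_comp o_def)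
    have snd_C: "size (filter_mset snd ?C) = ?w" "size ?C = size K"
      by (simp_all add: complement_strictness_def filter_mset_image_mset o_def)
    have size: "size K = ?s + ?w"
      by (metis multiset_partition size_union)
    have "is_h_polynomial b K (monom 1 ?s)"
      using less.prems True
      by (auto simp: is_h_polynomial_def flow_series_alternating eval_real_monom)
    moreover have "is_h_polynomial b ?C (monom 1 ?w)"
      using less.prems True unfolding is_h_polynomial_def
      by (auto simp: flow_series_alternating fst_C snd_C eval_real_monom)
    moreover have "coeff (monom (1::int) ?s) 0 = of_bool (\<forall>x \<in># K. \<not> snd x)"
      by (simp add: Ball_def)
    ultimately show ?thesis
      using size by (intro exI[of _ "monom 1 ?s"] exI[of _ "monom 1 ?w"]) auto
  next
    case False
    then obtain i j k where "i < j" "j < k" "(i, j) \<in># image_mset fst K" "(j, k) \<in># image_mset fst K"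
      unfolding alternating_def by blast
    then obtain s t where ijk: "i < j" "j < k" "((i, j), s) \<in># K" "((j, k), t) \<in># K"
      by (auto simp: image_iff)
    then obtain L where "K = add_mset ((i, j), s) L"
      by (meson mset_add)
    moreover from this ijk obtain R where "L = add_mset ((j, k), t) R"
      by (metis insert_noteq_member mset_add nat_neq_iff prod.inject)
    ultimately have K: "K = add_mset ((i, j), s) (add_mset ((j, k), t) R)" by simp
    have "k \<le> b"
      using less.prems by (auto simp: K admissible_def)
    \<comment> \<open>Either value of \<open>u\<close> is possible if \<open>s = t\<close>, and only this one otherwise.\<close>
    define u where "u = (\<not> (s \<longrightarrow> t))"
    have u: "if u then t \<longrightarrow> s else s \<longrightarrow> t"
      by (auto simp: u_def)
    have u': "if \<not> u then \<not> t \<longrightarrow> \<not> s else \<not> s \<longrightarrow> \<not> t"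
      by (auto simp: u_def)
    define K1 where "K1 = add_mset ((i, k), t) (add_mset ((i, j), u) R)"
    define K2 where "K2 = add_mset ((i, k), s) (add_mset ((j, k), \<not> u) R)"
    have size: "size K1 = size K" "size K2 = size K"
      by (simp_all add: K K1_def K2_def)
    have "image_mset fst K = {#(i, j), (j, k)#} + image_mset fst R"
      "image_mset fst K1 = {#(i, k), (i, j)#} + image_mset fst R"
      "image_mset fst K2 = {#(i, k), (j, k)#} + image_mset fst R"
      by (simp_all add: K K1_def K2_def)
    then have "deficit b (image_mset fst K1) < deficit b (image_mset fst K)"
      "deficit b (image_mset fst K2) < deficit b (image_mset fst K)"
      using deficit_split(1,2)[OF ijk(1,2) \<open>k \<le> b\<close>]
      by (simp_all only: deficit_union add_less_cancel_right)
    moreover have "admissible b (image_mset fst K1)" "admissible b (image_mset fst K2)"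
      using less.prems ijk(1,2) by (auto simp: K K1_def K2_def admissible_def)
    ultimately obtain h1 h1' h2 h2' where
      h1: "is_h_polynomial b K1 h1" "is_h_polynomial b (complement_strictness K1) h1'"
        "\<And>i. size K < i \<Longrightarrow> coeff h1 i = 0 \<and> coeff h1' i = 0"
        "\<And>i. i \<le> size K \<Longrightarrow> coeff h1' i = coeff h1 (size K - i)"
        "coeff h1 0 = of_bool (\<forall>x \<in># K1. \<not> snd x)" and
      h2: "is_h_polynomial b K2 h2" "is_h_polynomial b (complement_strictness K2) h2'"
        "\<And>i. size K < i \<Longrightarrow> coeff h2 i = 0 \<and> coeff h2' i = 0"
        "\<And>i. i \<le> size K \<Longrightarrow> coeff h2' i = coeff h2 (size K - i)"
        "coeff h2 0 = of_bool (\<forall>x \<in># K2. \<not> snd x)"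
      using less.hyps[of K1] less.hyps[of K2] unfolding size by blast
    have "is_h_polynomial b K (h1 + h2)"
      by (rule is_h_polynomial_add[OF h1(1) h2(1) size])
        (simp add: K K1_def K2_def flow_series_split[OF u])
    moreover have "is_h_polynomial b (complement_strictness K) (h1' + h2')"
    proof (rule is_h_polynomial_add[OF h1(2) h2(2)])
      show "flow_series b z (complement_strictness K) =
          flow_series b z (complement_strictness K1) + flow_series b z (complement_strictness K2)" for z
        using flow_series_split[OF u', of b z i j k "complement_strictness R"]
        by (simp add: K K1_def K2_def complement_strictness_def)
    qed (simp_all add: complement_strictness_def size)
    moreover have "coeff (h1 + h2) 0 = of_bool (\<forall>x \<in># K. \<not> snd x)"
      unfolding coeff_add h1(5) h2(5) by (auto simp: K K1_def K2_def u_def)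
    ultimately show ?thesis
      using h1(3,4) h2(3,4)
      by (intro exI[of _ "h1 + h2"] exI[of _ "h1' + h2'"]) auto
  qed
qed

definition all_weak :: "(nat \<times> nat) multiset \<Rightarrow> ((nat \<times> nat) \<times> bool) multiset" where
  "all_weak K = image_mset (\<lambda>e. (e, False)) K"

definition h_polynomial :: "nat \<Rightarrow> (nat \<times> nat) multiset \<Rightarrow> int poly" where
  "h_polynomial b K = (THE h. is_h_polynomial b (all_weak K) h)"

lemma image_fst_all_weak [simp]: "image_mset fst (all_weak K) = K"
  by (simp add: all_weak_def multiset.map_comp o_def)

lemma size_all_weak [simp]: "size (all_weak K) = size K"
  by (simp add: all_weak_def)

lemma h_polynomial_eqI: "is_h_polynomial b (all_weak K) h \<Longrightarrow> h_polynomial b K = h"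
  unfolding h_polynomial_def by (blast intro: the_equality is_h_polynomial_unique)

lemma is_h_polynomial_h_polynomial:
  assumes "admissible b K"
  shows "is_h_polynomial b (all_weak K) (h_polynomial b K)"
  using exists_h_polynomial[of b "all_weak K"] assms h_polynomial_eqI by fastforce

lemma h_polynomial_nonneg: "admissible b K \<Longrightarrow> 0 \<le> coeff (h_polynomial b K) i"
  using is_h_polynomial_h_polynomial by (simp add: is_h_polynomial_def)

lemma h_polynomial_alternating:
  assumes "admissible b K" "alternating K"
  shows "h_polynomial b K = 1"
proof (rule h_polynomial_eqI)
  have "size (filter_mset snd (all_weak K)) = 0"
    by (auto simp: all_weak_def)
  then show "is_h_polynomial b (all_weak K) 1"
    using assms eval_real_monom[of 1 0]
    by (simp add: is_h_polynomial_def flow_series_alternating del: size_eq_0_iff_empty)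
qed

text \<open>
  The replacement rule with \<open>\<beta> = z - 1\<close>. Splitting leaves a strict edge \<open>j \<rightarrow> k\<close> in the second part.
  A weak edge carries either nothing or at least one unit, so strict equals weak minus absent, and
  dropping an edge costs a factor \<open>1 - z\<close> in the normalization.
\<close>

lemma h_polynomial_relation:
  assumes "admissible b K" "i < j" "j < k" "k \<le> b"
  shows "h_polynomial b (add_mset (i, j) (add_mset (j, k) K)) =
    h_polynomial b (add_mset (i, k) (add_mset (i, j) K)) +
    h_polynomial b (add_mset (i, k) (add_mset (j, k) K)) +
    [:-1, 1:] * h_polynomial b (add_mset (i, k) K)"
proof -
  let ?K1 = "add_mset (i, k) (add_mset (i, j) K)" and ?K2 = "add_mset (i, k) (add_mset (j, k) K)"
  let ?S = "add_mset ((i, k), False) (add_mset ((j, k), True) (all_weak K))"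
  have adm: "admissible b ?K1" "admissible b ?K2" "admissible b (add_mset (i, k) K)"
    using assms by (auto simp: admissible_def)
  have "admissible b (image_mset fst ?S)"
    using adm(2) by simp
  then obtain h where h: "is_h_polynomial b ?S h"
    using exists_h_polynomial by blast
  have "is_h_polynomial b (all_weak (add_mset (i, j) (add_mset (j, k) K))) (h_polynomial b ?K1 + h)"
    by (rule is_h_polynomial_add[OF is_h_polynomial_h_polynomial[OF adm(1)] h])
      (simp_all add: all_weak_def flow_series_split[of False])
  then have 1: "h_polynomial b (add_mset (i, j) (add_mset (j, k) K)) = h_polynomial b ?K1 + h"
    by (rule h_polynomial_eqI)
  have 2: "h_polynomial b ?K2 = [:1, -1:] * h_polynomial b (add_mset (i, k) K) + h"
  proof (rule eval_real_eqI)
    fix z :: real assume z: "0 < z" "z < 1"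
    have "flow_series b z (all_weak ?K2) = flow_series b z (all_weak (add_mset (i, k) K)) + flow_series b z ?S"
      using flow_series_weak[of b z "(j, k)" "add_mset ((i, k), False) (all_weak K)"]
      by (simp add: all_weak_def add_mset_commute)
    moreover have ge: "0 \<le> eval_real h z" "0 \<le> eval_real (h_polynomial b ?K2) z"
        "0 \<le> eval_real (h_polynomial b (add_mset (i, k) K)) z"
      using z h h_polynomial_nonneg adm eval_real_nonneg unfolding is_h_polynomial_def by auto
    ultimately have "ennreal (eval_real (h_polynomial b ?K2) z / (1 - z) ^ size ?K2) =
        ennreal (eval_real (h_polynomial b (add_mset (i, k) K)) z / (1 - z) ^ size (add_mset (i, k) K)
          + eval_real h z / (1 - z) ^ size ?S)"
      using z h is_h_polynomial_h_polynomial[OF adm(2)] is_h_polynomial_h_polynomial[OF adm(3)]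
      unfolding is_h_polynomial_def by (subst ennreal_plus) auto
    then have *: "eval_real (h_polynomial b ?K2) z / (1 - z) ^ size ?K2 =
        eval_real (h_polynomial b (add_mset (i, k) K)) z / (1 - z) ^ size (add_mset (i, k) K)
          + eval_real h z / (1 - z) ^ size ?S"
      using ge z by (subst (asm) ennreal_inj) auto
    show "eval_real (h_polynomial b ?K2) z =
        eval_real ([:1, -1:] * h_polynomial b (add_mset (i, k) K) + h) z"
    proof -
      have y: "A / y ^ Suc (Suc l) = B / y ^ Suc l + C / y ^ Suc (Suc l) \<Longrightarrow> A = y * B + C"
        if "y > 0" for A B C y :: real and l
        using that by (simp add: field_simps)
      have "eval_real [:1, -1:] z = 1 - z"
        by (simp add: eval_real_pCons)
      then show ?thesis
        using y[of "1 - z"] z * by (simp only: eval_real_add eval_real_mult) simp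
    qed
  qed
  show ?thesis
    unfolding 1 2 by (simp add: algebra_simps)
qed

section \<open>Replacements preserve the value\<close>

definition edges_of :: "monomial \<Rightarrow> (nat \<times> nat) multiset" where
  "edges_of M = Abs_multiset (Poly_Mapping.lookup M)"

lemma count_edges_of [simp]: "count (edges_of M) e = Poly_Mapping.lookup M e"
proof -
  have "finite {e. 0 < Poly_Mapping.lookup M e}"
    using finite_keys[of M] by (simp add: keys.rep_eq)
  then show ?thesis
    by (simp add: edges_of_def count_Abs_multiset)
qed

lemma edges_of_add: "edges_of (M + M') = edges_of M + edges_of M'"
  by (rule multiset_eqI) (simp add: lookup_add)

lemma edges_of_single: "edges_of (Poly_Mapping.single e k) = replicate_mset k e"
  by (rule multiset_eqI) (simp add: lookup_single when_def)

lemma in_edges_of_iff: "e \<in># edges_of M \<longleftrightarrow> 0 < Poly_Mapping.lookup M e"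
  by (simp flip: count_greater_zero_iff)

text \<open>
  Composition with \<open>1 + \<beta>\<close> substitutes \<open>z = 1 + \<beta>\<close>.
\<close>

definition monomial_value :: "nat \<Rightarrow> monomial \<Rightarrow> int poly" where
  "monomial_value b M = pcompose (h_polynomial b (edges_of M)) [:1, 1:]"

definition value_functional :: "nat \<Rightarrow> xpoly \<Rightarrow> int poly" where
  "value_functional b p =
     (\<Sum>M\<in>Poly_Mapping.keys p. Poly_Mapping.lookup p M * monomial_value b M)"

definition admissible_xpoly :: "nat \<Rightarrow> xpoly \<Rightarrow> bool" where
  "admissible_xpoly b p \<longleftrightarrow> (\<forall>M\<in>Poly_Mapping.keys p. admissible b (edges_of M))"

lemma value_functional_add: "value_functional b (p + q) = value_functional b p + value_functional b q"
  unfolding value_functional_def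
  by (rule setsum_keys_plus_distrib) (simp_all add: algebra_simps)

lemma value_functional_single: "value_functional b (Poly_Mapping.single M c) = c * monomial_value b M"
  by (simp add: value_functional_def)

lemma monomial_value_relation:
  assumes "admissible b (edges_of R)" "i < j" "j < k" "k \<le> b"
  shows "monomial_value b (Poly_Mapping.single (i, j) 1 + Poly_Mapping.single (j, k) 1 + R) =
    monomial_value b (R + (Poly_Mapping.single (i, k) 1 + Poly_Mapping.single (i, j) 1)) +
    monomial_value b (R + (Poly_Mapping.single (j, k) 1 + Poly_Mapping.single (i, k) 1)) +
    [:0, 1:] * monomial_value b (R + Poly_Mapping.single (i, k) 1)"
proof -
  have "pcompose [:-1, 1:] [:1, 1:] = ([:0, 1:] :: int poly)"
    by (simp add: pcompose_pCons)
  moreover have "monomial_value b (Poly_Mapping.single (i, j) 1 + Poly_Mapping.single (j, k) 1 + R) =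
    pcompose (h_polynomial b (add_mset (i, j) (add_mset (j, k) (edges_of R)))) [:1, 1:]"
    by (simp add: monomial_value_def edges_of_add edges_of_single add_mset_commute)
  moreover have "monomial_value b (R + (Poly_Mapping.single (i, k) 1 + Poly_Mapping.single (i, j) 1)) =
    pcompose (h_polynomial b (add_mset (i, k) (add_mset (i, j) (edges_of R)))) [:1, 1:]"
    by (simp add: monomial_value_def edges_of_add edges_of_single add_mset_commute)
  moreover have "monomial_value b (R + (Poly_Mapping.single (j, k) 1 + Poly_Mapping.single (i, k) 1)) =
    pcompose (h_polynomial b (add_mset (i, k) (add_mset (j, k) (edges_of R)))) [:1, 1:]"
    by (simp add: monomial_value_def edges_of_add edges_of_single add_mset_commute)
  moreover have "monomial_value b (R + Poly_Mapping.single (i, k) 1) =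
    pcompose (h_polynomial b (add_mset (i, k) (edges_of R))) [:1, 1:]"
    by (simp add: monomial_value_def edges_of_add edges_of_single)
  ultimately show ?thesis
    by (simp only: h_polynomial_relation[OF assms] pcompose_add pcompose_mult)
qed

lemma single_times_relation:
  "Poly_Mapping.single R c * (X i k * X i j + X j k * X i k + \<beta> * X i k) =
    Poly_Mapping.single (R + (Poly_Mapping.single (i, k) 1 + Poly_Mapping.single (i, j) 1)) c +
    Poly_Mapping.single (R + (Poly_Mapping.single (j, k) 1 + Poly_Mapping.single (i, k) 1)) c +
    Poly_Mapping.single (R + Poly_Mapping.single (i, k) 1) (c * [:0, 1:])"
  by (simp only: X_def \<beta>_def mult_single distrib_left mult_1_right mult_1_left add_0_left)

lemma admissible_relation:
  assumes "admissible b (edges_of (Poly_Mapping.single (i, j) 1 + Poly_Mapping.single (j, k) 1 + R))"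
    and "i < j" "j < k"
  shows "admissible b (edges_of R)" "k \<le> b"
    "admissible b (edges_of (R + (Poly_Mapping.single (i, k) 1 + Poly_Mapping.single (i, j) 1)))"
    "admissible b (edges_of (R + (Poly_Mapping.single (j, k) 1 + Poly_Mapping.single (i, k) 1)))"
    "admissible b (edges_of (R + Poly_Mapping.single (i, k) 1))"
  using assms by (auto simp: admissible_def edges_of_add edges_of_single)

lemma keys_diff_single_lookup:
  fixes p :: xpoly
  shows "Poly_Mapping.keys (p - Poly_Mapping.single M (Poly_Mapping.lookup p M)) = Poly_Mapping.keys p - {M}"
  by (auto simp: in_keys_iff lookup_minus lookup_single when_def split: if_splits)

text \<open>
  One step trades a monomial for at most three of smaller deficit, and \<open>3 \<cdot> 4\<^bsup>l\<^esup> < 4\<^bsup>l + 1\<^esup>\<close>. Coefficients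
  that cancel or merge only lower the sum, so it decreases in every step.
\<close>

definition termination_potential :: "nat \<Rightarrow> xpoly \<Rightarrow> nat" where
  "termination_potential b p = (\<Sum>M\<in>Poly_Mapping.keys p. 4 ^ deficit b (edges_of M))"

lemma reduction_step_properties:
  assumes "reduction_step p q" "admissible_xpoly b p"
  shows "value_functional b q = value_functional b p"
    and "admissible_xpoly b q"
    and "termination_potential b q < termination_potential b p"
proof -
  from assms(1) obtain i j k M c R where
    q: "q = p - Poly_Mapping.single M c
        + Poly_Mapping.single R c * (X i k * X i j + X j k * X i k + \<beta> * X i k)"
    and ijk: "i < j" "j < k" and M: "M \<in> Poly_Mapping.keys p" "c = Poly_Mapping.lookup p M"
    and M_eq: "M = Poly_Mapping.single (i, j) 1 + Poly_Mapping.single (j, k) 1 + R"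
    by (cases rule: reduction_step.cases) blast
  let ?M1 = "R + (Poly_Mapping.single (i, k) 1 + Poly_Mapping.single (i, j) 1)"
  let ?M2 = "R + (Poly_Mapping.single (j, k) 1 + Poly_Mapping.single (i, k) 1)"
  let ?M3 = "R + Poly_Mapping.single (i, k) 1"
  let ?p = "p - Poly_Mapping.single M c"
  have "admissible b (edges_of M)"
    using assms(2) M(1) by (simp add: admissible_xpoly_def)
  note adm = admissible_relation[OF this[unfolded M_eq] ijk]
  have q': "q = ?p + (Poly_Mapping.single ?M1 c + Poly_Mapping.single ?M2 c
      + Poly_Mapping.single ?M3 (c * [:0, 1:]))"
    unfolding q single_times_relation ..
  note relation = monomial_value_relation[OF adm(1) ijk adm(2), folded M_eq]
  have "value_functional b p = value_functional b (?p + Poly_Mapping.single M c)"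
    by simp
  also have "\<dots> = value_functional b ?p + c * monomial_value b M"
    by (simp only: value_functional_add value_functional_single)
  also have "\<dots> = value_functional b q"
    unfolding q' value_functional_add value_functional_single relation
    by (simp only: distrib_left ac_simps)
  finally show "value_functional b q = value_functional b p" ..
  have "Poly_Mapping.keys q \<subseteq> Poly_Mapping.keys ?p \<union> (Poly_Mapping.keys (Poly_Mapping.single ?M1 c)
      \<union> Poly_Mapping.keys (Poly_Mapping.single ?M2 c)
      \<union> Poly_Mapping.keys (Poly_Mapping.single ?M3 (c * [:0, 1:])))"
    unfolding q' by (intro order_trans[OF keys_add] Un_mono subset_refl)
  also have "\<dots> \<subseteq> (Poly_Mapping.keys p - {M}) \<union> {?M1, ?M2, ?M3}"
    unfolding M(2) keys_diff_single_lookup by auto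
  finally have keys: "Poly_Mapping.keys q \<subseteq> (Poly_Mapping.keys p - {M}) \<union> {?M1, ?M2, ?M3}" .
  then show "admissible_xpoly b q"
    using adm(3-5) assms(2) unfolding admissible_xpoly_def by blast
  let ?w = "\<lambda>M. 4 ^ deficit b (edges_of M) :: nat"
  have edges: "edges_of M = {#(i, j), (j, k)#} + edges_of R"
    "edges_of ?M1 = {#(i, k), (i, j)#} + edges_of R"
    "edges_of ?M2 = {#(i, k), (j, k)#} + edges_of R"
    "edges_of ?M3 = {#(i, k)#} + edges_of R"
    unfolding M_eq edges_of_add edges_of_single by (simp_all add: add_mset_commute)
  have less: "deficit b (edges_of ?M1) < deficit b (edges_of M)"
    "deficit b (edges_of ?M2) < deficit b (edges_of M)"
    "deficit b (edges_of ?M3) < deficit b (edges_of M)"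
    unfolding edges deficit_union using deficit_split[OF ijk adm(2)] by simp_all
  then obtain l where l: "deficit b (edges_of M) = Suc l"
    by (cases "deficit b (edges_of M)") auto
  have le: "?w ?M1 \<le> 4 ^ l" "?w ?M2 \<le> 4 ^ l" "?w ?M3 \<le> 4 ^ l"
    using less unfolding l by (intro power_increasing; simp)+
  have "termination_potential b q \<le> sum ?w ((Poly_Mapping.keys p - {M}) \<union> {?M1, ?M2, ?M3})"
    unfolding termination_potential_def by (intro sum_mono2 keys) auto
  also have "\<dots> \<le> sum ?w (Poly_Mapping.keys p - {M}) + sum ?w {?M1, ?M2, ?M3}"
    by (simp only: sum.union_inter[symmetric] finite_keys finite_Diff finite.intros)
  also have "sum ?w {?M1, ?M2, ?M3} \<le> ?w ?M1 + (?w ?M2 + ?w ?M3)"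
    by (simp add: sum.insert_if)
  also have "\<dots> \<le> 3 * 4 ^ l"
    using add_mono[OF le(1) add_mono[OF le(2,3)]] by simp
  also have "\<dots> < ?w M"
    unfolding l by simp
  also have "sum ?w (Poly_Mapping.keys p - {M}) + ?w M = termination_potential b p"
    unfolding termination_potential_def using M(1) by (simp add: sum.remove)
  finally show "termination_potential b q < termination_potential b p" by simp
qed

lemma reduction_steps_properties:
  assumes "reduction_step\<^sup>*\<^sup>* p q" "admissible_xpoly b p"
  shows "value_functional b q = value_functional b p" "admissible_xpoly b q"
proof -
  from assms have "value_functional b q = value_functional b p \<and> admissible_xpoly b q"
    by (induction rule: rtranclp_induct) (use reduction_step_properties in metis)+
  then show "value_functional b q = value_functional b p" "admissible_xpoly b q" by auto
qed

lemma reduced_iff_alternating: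
  "reduced p \<longleftrightarrow> (\<forall>M\<in>Poly_Mapping.keys p. alternating (edges_of M))"
  by (simp add: reduced_def alternating_def in_edges_of_iff)

lemma exists_reduced_polynomial:
  assumes "admissible_xpoly b p"
  shows "\<exists>r. reduced_polynomial_of p r"
  using assms
proof (induction "termination_potential b p" arbitrary: p rule: less_induct)
  case less
  show ?case
  proof (cases "reduced p")
    case True
    then show ?thesis by (auto simp: reduced_polynomial_of_def)
  next
    case False
    then obtain M i j k where M: "M \<in> Poly_Mapping.keys p" and ijk: "i < j" "j < k"
      and pos: "Poly_Mapping.lookup M (i, j) > 0" "Poly_Mapping.lookup M (j, k) > 0"
      by (auto simp: reduced_def)
    define R where "R = M - (Poly_Mapping.single (i, j) 1 + Poly_Mapping.single (j, k) 1)"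
    have "M = Poly_Mapping.single (i, j) 1 + Poly_Mapping.single (j, k) 1 + R"
      using pos ijk by (intro poly_mapping_eqI)
        (auto simp: R_def lookup_add lookup_minus lookup_single when_def)
    from reduction_step.intros[OF ijk M refl this] obtain q where q: "reduction_step p q"
      by blast
    obtain r where "reduced_polynomial_of q r"
      using less.hyps[of q] reduction_step_properties[OF q less.prems] by blast
    with q show ?thesis
      unfolding reduced_polynomial_of_def by (meson converse_rtranclp_into_rtranclp)
  qed
qed

lemma value_functional_reduced:
  assumes "admissible_xpoly b r" "reduced r"
  shows "value_functional b r = evaluate (\<lambda>i j. 1) r"
  using assms unfolding value_functional_def evaluate_def admissible_xpoly_def reduced_iff_alternating
  by (intro sum.cong) (auto simp: monomial_value_def h_polynomial_alternating pcompose_1)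

text \<open>
  A \<open>\<int>[\<beta>]\<close>-linear functional that is invariant under every replacement and agrees with
  evaluation at \<open>1\<close> on reduced polynomials determines the value of all reduced polynomials;
  termination shows that there is one.
\<close>

theorem is_reduced_value_iff:
  assumes "admissible_xpoly b p"
  shows "is_reduced_value p v \<longleftrightarrow> v = value_functional b p"
proof -
  have "evaluate (\<lambda>i j. 1) r = value_functional b p" if "reduced_polynomial_of p r" for r
    using that reduction_steps_properties[of p r b] value_functional_reduced[of b r] assms
    by (simp add: reduced_polynomial_of_def)
  then show ?thesis
    using exists_reduced_polynomial[OF assms] unfolding is_reduced_value_def by metis
qed

lemma X_power: "X i j ^ k = Poly_Mapping.single (Poly_Mapping.single (i, j) k) 1"
proof (induction k)
  case (Suc k)
  then show ?case
    by (simp add: X_def mult_single flip: single_add)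
qed simp

lemma reduced_value_single:
  assumes "admissible b (edges_of M)"
  shows "\<exists>!v. is_reduced_value (Poly_Mapping.single M 1) v"
    and "reduced_value (Poly_Mapping.single M 1) = pcompose (h_polynomial b (edges_of M)) [:1, 1:]"
proof -
  have "admissible_xpoly b (Poly_Mapping.single M 1)"
    using assms by (simp add: admissible_xpoly_def)
  then have *: "is_reduced_value (Poly_Mapping.single M 1) v \<longleftrightarrow>
      v = pcompose (h_polynomial b (edges_of M)) [:1, 1:]" for v
    by (simp add: is_reduced_value_iff value_functional_single monomial_value_def)
  then show "\<exists>!v. is_reduced_value (Poly_Mapping.single M 1) v"
    and "reduced_value (Poly_Mapping.single M 1) = pcompose (h_polynomial b (edges_of M)) [:1, 1:]"
    by (simp_all add: reduced_value_def)
qed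

lemma pcompose_translate_back:
  "pcompose (pcompose h [:1, 1:]) ([:0, 1:] - 1) = (h :: int poly)"
proof -
  have "pcompose [:1, 1:] ([:0, 1:] - 1) = ([:0, 1:] :: int poly)"
    by (simp add: pcompose_pCons)
  then show ?thesis
    by (simp add: pcompose_assoc[symmetric] pcompose_idR)
qed

section \<open>Palindromic h-polynomials and the path graph\<close>

lemma fold_push_shift:
  "fold_mset push \<phi> L (\<lambda>v. d v + c v) = fold_mset push (\<lambda>d. \<phi> (\<lambda>v. d v + c v)) L d"
proof (induction L arbitrary: d)
  case (add x L)
  have "push x (fold_mset push \<phi> L) (\<lambda>v. d v + c v) =
      (\<integral>\<^sup>+ a. fold_mset push \<phi> L
        (\<lambda>v. (d v + int (a + of_bool (snd x)) * edge_vector (fst x) v) + c v) \<partial>count_space UNIV)"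
    by (simp add: push_def algebra_simps)
  also have "\<dots> = push x (fold_mset push (\<lambda>d. \<phi> (\<lambda>v. d v + c v)) L) d"
    unfolding add.IH push_def ..
  finally show ?case by simp
qed simp

text \<open>
  Sending one compulsory unit over every edge first leaves a weak problem with a shifted starting
  vector.
\<close>

lemma fold_push_strict:
  "fold_mset push \<phi> (complement_strictness (all_weak K)) d =
     fold_mset push \<phi> (all_weak K) (\<lambda>v. d v + (\<Sum>e\<in>#K. edge_vector e v))"
proof (induction K arbitrary: d)
  case (add e K)
  have "push (e, True) (fold_mset push \<phi> (complement_strictness (all_weak K))) d =
    push (e, False) (fold_mset push \<phi> (all_weak K)) (\<lambda>v. d v + (\<Sum>e\<in>#add_mset e K. edge_vector e v))"
    unfolding push_def add.IH by (simp add: algebra_simps)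
  then show ?case
    by (simp add: complement_strictness_def all_weak_def)
qed (simp add: complement_strictness_def all_weak_def)

text \<open>
  Only the vectors that can be reached along the edges of \<open>L\<close> matter; \<open>D\<close> is a set that contains
  them.
\<close>

lemma fold_push_scale:
  assumes "\<And>d. d \<in> D \<Longrightarrow> \<psi> d = \<kappa> * \<phi> d"
    and "\<And>x d a. x \<in># L \<Longrightarrow> d \<in> D \<Longrightarrow> (\<lambda>v. d v + int a * edge_vector (fst x) v) \<in> D"
    and "d \<in> D"
  shows "fold_mset push \<psi> L d = \<kappa> * fold_mset push \<phi> L d"
  using assms(2,3)
proof (induction L arbitrary: d)
  case empty
  then show ?case by (simp add: assms(1))
next
  case (add x L)
  have "fold_mset push \<psi> L (\<lambda>v. d v + int (a + of_bool (snd x)) * edge_vector (fst x) v) =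
      \<kappa> * fold_mset push \<phi> L (\<lambda>v. d v + int (a + of_bool (snd x)) * edge_vector (fst x) v)" for a
    using add.prems(1)[of x d "a + of_bool (snd x)"] add.prems by (intro add.IH) simp_all
  then have "push x (fold_mset push \<psi> L) d = \<kappa> * push x (fold_mset push \<phi> L) d"
    by (simp add: push_def nn_integral_cmult)
  then show ?case by simp
qed

text \<open>
  If one unit on every edge amounts to \<open>m\<close> units from \<open>s\<close> to \<open>t\<close>, these \<open>m\<close> units raise the exponent
  by exactly \<open>m\<close>: the net outflow is never negative at \<open>s\<close>, where no edge ends, and never positive
  at \<open>t\<close>, where no edge begins.
\<close>

lemma flow_series_strict:
  assumes "s \<noteq> t" "s \<le> b"
    and K: "\<And>e. e \<in># K \<Longrightarrow> snd e \<noteq> s \<and> fst e \<noteq> t"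
    and balanced: "\<And>v. (\<Sum>e\<in>#K. edge_vector e v) = int m * edge_vector (s, t) v"
    and z: "0 < z"
  shows "flow_series b z (complement_strictness (all_weak K)) =
    ennreal (z ^ m) * flow_series b z (all_weak K)"
proof -
  let ?c = "\<lambda>v. int m * edge_vector (s, t) v"
  have "flow_series b z (complement_strictness (all_weak K)) =
      fold_mset push (\<lambda>d. supply_weight b z (\<lambda>v. d v + ?c v)) (all_weak K) (\<lambda>_. 0)"
    unfolding flow_series_def fold_push_strict balanced fold_push_shift ..
  also have "\<dots> = ennreal (z ^ m) * fold_mset push (supply_weight b z) (all_weak K) (\<lambda>_. 0)"
  proof (rule fold_push_scale[where D = "{d. 0 \<le> d s \<and> d t \<le> 0}"])
    fix d :: "nat \<Rightarrow> int" assume "d \<in> {d. 0 \<le> d s \<and> d t \<le> 0}"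
    then have "nat (d v + ?c v) = (if v = s then m else 0) + nat (d v)" for v
      using assms(1) by (auto simp: edge_vector_def nat_add_distrib)
    then have "(\<Sum>v\<le>b. nat (d v + ?c v)) = m + (\<Sum>v\<le>b. nat (d v))"
      using assms(2) by (simp add: sum.distrib)
    then show "supply_weight b z (\<lambda>v. d v + ?c v) = ennreal (z ^ m) * supply_weight b z d"
      using z by (simp add: supply_weight_def power_add ennreal_mult)
  next
    fix x d a assume x: "x \<in># all_weak K" and d: "d \<in> {d::nat \<Rightarrow> int. 0 \<le> d s \<and> d t \<le> 0}"
    then have "snd (fst x) \<noteq> s" "fst (fst x) \<noteq> t"
      using K[of "fst x"] by (auto simp: all_weak_def)
    with d show "(\<lambda>v. d v + int a * edge_vector (fst x) v) \<in> {d. 0 \<le> d s \<and> d t \<le> 0}"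
      by (auto simp: edge_vector_def)
  qed simp
  finally show ?thesis
    unfolding flow_series_def .
qed

text \<open>
  The h-polynomial \<open>h'\<close> of the all-strict graph is the mirror image of \<open>h\<close> in degree \<open>size K\<close>, and it
  is also \<open>z\<^bsup>m\<^esup> h\<close>. So \<open>h\<close> is its own mirror image in degree \<open>size K - m\<close>, and this is the degree of
  \<open>h\<close> since the constant coefficient is \<open>1\<close>.
\<close>

lemma h_polynomial_symmetric:
  assumes adm: "admissible b K"
    and "s \<noteq> t" "s \<le> b"
    and K: "\<And>e. e \<in># K \<Longrightarrow> snd e \<noteq> s \<and> fst e \<noteq> t"
    and balanced: "\<And>v. (\<Sum>e\<in>#K. edge_vector e v) = int m * edge_vector (s, t) v"
  shows "symmetric_poly (h_polynomial b K)"
proof -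
  define h where "h = h_polynomial b K"
  have "admissible b (image_mset fst (all_weak K))"
    using adm by simp
  from exists_h_polynomial[OF this] obtain h' where
    h: "is_h_polynomial b (all_weak K) h"
      "is_h_polynomial b (complement_strictness (all_weak K)) h'"
      "\<And>i. size K < i \<Longrightarrow> coeff h i = 0 \<and> coeff h' i = 0"
      "\<And>i. i \<le> size K \<Longrightarrow> coeff h' i = coeff h (size K - i)"
      "coeff h 0 = of_bool (\<forall>x \<in># all_weak K. \<not> snd x)"
    unfolding h_def using h_polynomial_eqI by (metis size_all_weak)
  have h0: "coeff h 0 = 1"
    using h(5) by (auto simp: all_weak_def)
  have "is_h_polynomial b (complement_strictness (all_weak K)) (monom 1 m * h)"
    unfolding is_h_polynomial_def
  proof (intro conjI allI impI)
    show "0 \<le> coeff (monom 1 m * h) i" for i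
      using h(1) by (simp add: coeff_monom_mult is_h_polynomial_def)
    fix z :: real assume z: "0 < z" "z < 1"
    show "flow_series b z (complement_strictness (all_weak K)) =
        ennreal (eval_real (monom 1 m * h) z / (1 - z) ^ size (complement_strictness (all_weak K)))"
      using h(1) z flow_series_strict[OF assms(2,3) K balanced z(1)]
      by (simp add: is_h_polynomial_def eval_real_mult eval_real_monom complement_strictness_def
          flip: ennreal_mult')
  qed
  then have h': "h' = monom 1 m * h"
    using h(2) is_h_polynomial_unique by blast
  have shift: "coeff h' (m + i) = coeff h i" for i
    by (simp add: h' coeff_monom_mult)
  have "m \<le> size K"
    using h(3)[of m] shift[of 0] h0 by (cases "m \<le> size K") auto
  have reverse: "coeff h i = coeff h (size K - m - i)" if "i \<le> size K - m" for i
    using h(4)[of "m + i"] shift[of i] that \<open>m \<le> size K\<close> by simp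
  have "coeff h i = 0" if "size K - m < i" for i
    using h(3)[of "m + i"] shift[of i] that \<open>m \<le> size K\<close> by simp
  moreover have "coeff h (size K - m) = 1"
    using reverse[of 0] h0 by simp
  ultimately have "degree h = size K - m"
    by (intro antisym degree_le le_degree) auto
  then show ?thesis
    using reverse unfolding symmetric_poly_def h_def by simp
qed

definition path_edges :: "nat \<Rightarrow> nat \<Rightarrow> (nat \<times> nat) multiset" where
  "path_edges n m = (\<Sum>i = 1..<n. replicate_mset m (i, i + 1))"

lemma path_edges_Suc:
  "1 \<le> n \<Longrightarrow> path_edges (Suc n) m = path_edges n m + replicate_mset m (n, n + 1)"
  by (simp add: path_edges_def sum.atLeastLessThan_Suc)

lemma in_path_edges: "e \<in># path_edges n m \<Longrightarrow> snd e = fst e + 1 \<and> 1 \<le> fst e \<and> fst e < n"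
  by (auto simp: path_edges_def set_mset_sum split: if_splits)

lemma path_edges_balanced:
  assumes "1 \<le> n"
  shows "(\<Sum>e\<in>#path_edges n m. edge_vector e v) = int m * edge_vector (1, n) v"
  using assms
proof (induction n rule: dec_induct)
  case base
  show ?case by (simp add: path_edges_def edge_vector_def)
next
  case (step n)
  then show ?case
    by (simp add: path_edges_Suc edge_vector_def algebra_simps)
qed

lemma h_polynomial_path_symmetric: "symmetric_poly (h_polynomial n (path_edges n m))"
proof (cases "2 \<le> n")
  case True
  show ?thesis
  proof (rule h_polynomial_symmetric)
    show "admissible n (path_edges n m)"
      by (auto simp: admissible_def dest: in_path_edges)
    show "(\<Sum>e\<in>#path_edges n m. edge_vector e v) = int m * edge_vector (1, n) v" for v
      using True by (intro path_edges_balanced) simp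
  qed (use True in \<open>auto dest: in_path_edges\<close>)
next
  case False
  then have "path_edges n m = {#}"
    by (simp add: path_edges_def)
  then have "h_polynomial n (path_edges n m) = 1"
    by (simp add: h_polynomial_alternating admissible_def alternating_def)
  then show ?thesis
    by (simp add: symmetric_poly_def)
qed

lemma path_monomial:
  "(\<Prod>i = 1..<n. X i (i + 1)) ^ m =
     Poly_Mapping.single (\<Sum>i = 1..<n. Poly_Mapping.single (i, i + 1) m) 1"
proof (induction n)
  case (Suc n)
  then show ?case
    by (cases "1 \<le> n") (simp_all add: power_mult_distrib X_power mult_single not_le)
qed simp

lemma edges_of_path:
  "edges_of (\<Sum>i = 1..<n. Poly_Mapping.single (i, i + 1) m) = path_edges n m"
proof (induction n)
  case 0
  show ?case by (rule multiset_eqI) (simp add: path_edges_def)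
next
  case (Suc n)
  show ?case
  proof (cases "1 \<le> n")
    case True
    then show ?thesis
      using Suc by (simp add: path_edges_Suc edges_of_add edges_of_single)
  next
    case False
    then show ?thesis
      by (intro multiset_eqI) (simp add: path_edges_def)
  qed
qed

section \<open>The path with two steps and Delannoy numbers\<close>

fun delannoy_poly :: "nat \<Rightarrow> nat \<Rightarrow> int poly" where
  "delannoy_poly 0 m = 1"
| "delannoy_poly (Suc n) 0 = 1"
| "delannoy_poly (Suc n) (Suc m) =
     delannoy_poly n (Suc m) + delannoy_poly (Suc n) m + [:0, 1:] * delannoy_poly n m"

text \<open>
  The rule replaces an edge \<open>1 \<rightarrow> 2\<close> or \<open>2 \<rightarrow> 3\<close> by \<open>1 \<rightarrow> 3\<close>, so the induction needs an arbitrary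
  number \<open>l\<close> of such edges, on which the result does not depend.
\<close>

lemma h_polynomial_two_step_path:
  "pcompose (h_polynomial 3 (replicate_mset n (1, 2) + replicate_mset m (2, 3)
      + replicate_mset l (1, 3))) [:1, 1:] = delannoy_poly n m"
proof (induction n m arbitrary: l rule: delannoy_poly.induct)
  case (1 m)
  have "h_polynomial 3 (replicate_mset m (2, 3) + replicate_mset l (1, 3)) = 1"
    by (rule h_polynomial_alternating) (auto simp: admissible_def alternating_def split: if_splits)
  then show ?case by (simp add: pcompose_1)
next
  case (2 n)
  have "h_polynomial 3 (replicate_mset (Suc n) (1, 2) + replicate_mset l (1, 3)) = 1"
    by (rule h_polynomial_alternating) (auto simp: admissible_def alternating_def split: if_splits)
  then show ?case by (simp add: pcompose_1)
next
  case (3 n m)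
  let ?K = "replicate_mset n (1, 2) + replicate_mset m (2, 3) + replicate_mset l (1::nat, 3::nat)"
  have "pcompose [:-1, 1:] [:1, 1:] = ([:0, 1:] :: int poly)"
    by (simp add: pcompose_pCons)
  moreover have "admissible 3 ?K"
    by (auto simp: admissible_def split: if_splits)
  note h_polynomial_relation[OF this, of 1 2 3]
  ultimately show ?case
    using "3.IH"(1)[of "Suc l"] "3.IH"(2)[of "Suc l"] "3.IH"(3)[of "Suc l"]
    by (simp add: pcompose_add pcompose_mult add_mset_commute add.commute
        del: mult_pCons_left mult_pCons_right)
qed

lemma coeff_X_mult:
  fixes p :: "int poly"
  shows "coeff ([:0, 1:] * p) k = (if k = 0 then 0 else coeff p (k - 1))"
  by (cases k) simp_all

text \<open>
  The right-hand side is the trinomial coefficient that counts the words with \<open>n - k\<close>, \<open>m - k\<close> and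
  \<open>k\<close> letters of three kinds; its Pascal recursion is that of the polynomials. Truncated subtraction
  is harmless: for \<open>k > n + m\<close> both sides vanish.
\<close>

lemma coeff_delannoy_poly:
  "coeff (delannoy_poly n m) k = int (((n + m - k) choose m) * (m choose k))"
proof (induction n m arbitrary: k rule: delannoy_poly.induct)
  case (1 m)
  show ?case by (cases k) (auto simp: coeff_1 binomial_eq_0)
next
  case (2 n)
  show ?case by (cases k) (auto simp: coeff_1)
next
  case (3 n m)
  show ?case
  proof (cases "n + m + 2 \<le> k")
    case True
    then show ?thesis
      by (cases k) (simp_all add: "3.IH" coeff_pCons binomial_eq_0)
  next
    case False
    \<comment> \<open>All three terms of the recursion have the same upper index \<open>r\<close>.\<close>
    then obtain r where r: "Suc n + Suc m - k = Suc r" "n + Suc m - k = r" "Suc n + m - k = r"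
        "k \<noteq> 0 \<Longrightarrow> n + m - (k - 1) = r"
      by (cases "Suc n + Suc m - k") auto
    have "(if k = 0 then 0 else int ((n + m - (k - 1) choose m) * (m choose (k - 1)))) =
        (if k = 0 then 0 else int ((r choose m) * (m choose (k - 1))))"
      using r(4) by simp
    moreover have "int ((Suc r choose Suc m) * (Suc m choose k)) =
        int ((r choose Suc m) * (Suc m choose k)) + int ((r choose m) * (m choose k)) +
        (if k = 0 then 0 else int ((r choose m) * (m choose (k - 1))))"
      by (cases k) (simp_all add: algebra_simps)
    ultimately show ?thesis
      by (simp only: delannoy_poly.simps coeff_add coeff_X_mult "3.IH" r(1-3))
  qed
qed

lemma delannoy_poly_trinomial:
  "delannoy_poly n m =
     (\<Sum>k = 0..min n m. of_nat ((n + m - k) choose m) * of_nat (m choose k) * [:0, 1:] ^ k)"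
proof (rule poly_eqI)
  fix i
  have "coeff (\<Sum>k = 0..min n m. of_nat ((n + m - k) choose m) * of_nat (m choose k) * [:0, 1:] ^ k) i
      = (\<Sum>k = 0..min n m. coeff (monom (int (((n + m - k) choose m) * (m choose k))) k) i)"
    unfolding coeff_sum by (intro sum.cong) (simp_all add: of_nat_poly monom_altdef)
  also have "\<dots> = (if i \<le> min n m then int (((n + m - i) choose m) * (m choose i)) else 0)"
    by simp
  also have "\<dots> = coeff (delannoy_poly n m) i"
    unfolding coeff_delannoy_poly by (auto simp: not_le binomial_eq_0)
  finally show "coeff (delannoy_poly n m) i =
    coeff (\<Sum>k = 0..min n m. of_nat ((n + m - k) choose m) * of_nat (m choose k) * [:0, 1:] ^ k) i" ..
qed

text \<open>
  The second closed form in the variable \<open>z = 1 + \<beta>\<close>, where its recursion follows from Pascal's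
  rule coefficient by coefficient.
\<close>

definition binomial_square_poly :: "nat \<Rightarrow> nat \<Rightarrow> int poly" where
  "binomial_square_poly n m = (\<Sum>k = 0..min n m. monom (int ((n choose k) * (m choose k))) k)"

lemma coeff_binomial_square_poly: "coeff (binomial_square_poly n m) k = int ((n choose k) * (m choose k))"
  by (auto simp: binomial_square_poly_def coeff_sum not_le binomial_eq_0)

lemma binomial_square_poly_recursion:
  "binomial_square_poly (Suc n) (Suc m) = binomial_square_poly n (Suc m)
     + binomial_square_poly (Suc n) m + [:-1, 1:] * binomial_square_poly n m"
proof (rule poly_eqI)
  fix k
  show "coeff (binomial_square_poly (Suc n) (Suc m)) k = coeff (binomial_square_poly n (Suc m)
     + binomial_square_poly (Suc n) m + [:-1, 1:] * binomial_square_poly n m) k"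
    by (cases k) (simp_all add: coeff_binomial_square_poly coeff_pCons algebra_simps)
qed

lemma delannoy_poly_binomial_square:
  "delannoy_poly n m = pcompose (binomial_square_poly n m) [:1, 1:]"
proof (induction n m rule: delannoy_poly.induct)
  case (3 n m)
  have "pcompose [:-1, 1:] [:1, 1:] = ([:0, 1:] :: int poly)"
    by (simp add: pcompose_pCons)
  then show ?case
    by (simp add: binomial_square_poly_recursion pcompose_add pcompose_mult 3
        del: mult_pCons_left mult_pCons_right)
qed (simp_all add: binomial_square_poly_def pcompose_1)

lemma delannoy_poly_shifted:
  "delannoy_poly n m =
     (\<Sum>k = 0..min n m. of_nat (n choose k) * of_nat (m choose k) * (1 + [:0, 1:]) ^ k)"
proof -
  have "1 + [:0, 1:] = ([:1, 1:] :: int poly)"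
    by (simp add: one_pCons)
  moreover have "pcompose (monom c k) [:1, 1:] = smult c ([:1, 1:] ^ k)" for c :: int and k
    by (induction k) (simp_all add: monom_0 monom_Suc pcompose_pCons)
  ultimately show ?thesis
    unfolding delannoy_poly_binomial_square binomial_square_poly_def pcompose_sum
    by (intro sum.cong) (simp_all add: of_nat_poly mult.commute)
qed

definition delannoy_paths_NE :: "nat \<Rightarrow> nat \<Rightarrow> nat \<Rightarrow> step list set" where
  "delannoy_paths_NE n m k = {s \<in> delannoy_paths n m. count_list s NE = k}"

lemma Nil_in_delannoy_paths: "[] \<in> delannoy_paths n m \<longleftrightarrow> n = 0 \<and> m = 0"
  by (auto simp: delannoy_paths_def zero_prod_def)

lemma Cons_in_delannoy_paths:
  "x # s \<in> delannoy_paths n m \<longleftrightarrow> fst (step_vector x) \<le> n \<and> snd (step_vector x) \<le> m \<and>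
     s \<in> delannoy_paths (n - fst (step_vector x)) (m - snd (step_vector x))"
  by (auto simp: delannoy_paths_def prod_eq_iff)

text \<open>
  Sorting the paths by their first step gives the recursion of the Delannoy polynomials.
\<close>

lemma delannoy_paths_NE_Suc_Suc:
  "delannoy_paths_NE (Suc n) (Suc m) k =
     (#) E ` delannoy_paths_NE n (Suc m) k \<union> (#) N ` delannoy_paths_NE (Suc n) m k \<union>
     (if k = 0 then {} else (#) NE ` delannoy_paths_NE n m (k - 1))"
proof (rule set_eqI)
  fix s
  show "s \<in> delannoy_paths_NE (Suc n) (Suc m) k \<longleftrightarrow> s \<in>
     (#) E ` delannoy_paths_NE n (Suc m) k \<union> (#) N ` delannoy_paths_NE (Suc n) m k \<union>
     (if k = 0 then {} else (#) NE ` delannoy_paths_NE n m (k - 1))"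
  proof (cases s)
    case Nil
    then show ?thesis by (auto simp: delannoy_paths_NE_def Nil_in_delannoy_paths)
  next
    case (Cons x s')
    then show ?thesis
      by (cases x) (auto simp: delannoy_paths_NE_def Cons_in_delannoy_paths)
  qed
qed

lemma delannoy_paths_0_left: "delannoy_paths 0 m = {replicate m N}"
proof (induction m)
  case 0
  have "s \<in> delannoy_paths 0 0 \<longleftrightarrow> s = []" for s
    by (cases s; cases "hd s") (auto simp: Nil_in_delannoy_paths Cons_in_delannoy_paths)
  then show ?case by auto
next
  case (Suc m)
  have "s \<in> delannoy_paths 0 (Suc m) \<longleftrightarrow> s = replicate (Suc m) N" for s
    by (cases s; cases "hd s") (auto simp: Nil_in_delannoy_paths Cons_in_delannoy_paths Suc)
  then show ?case by blast
qed

lemma delannoy_paths_0_right: "delannoy_paths n 0 = {replicate n E}"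
proof (induction n)
  case 0
  show ?case by (simp add: delannoy_paths_0_left)
next
  case (Suc n)
  have "s \<in> delannoy_paths (Suc n) 0 \<longleftrightarrow> s = replicate (Suc n) E" for s
    by (cases s; cases "hd s") (auto simp: Nil_in_delannoy_paths Cons_in_delannoy_paths Suc)
  then show ?case by blast
qed

lemma card_delannoy_paths_NE:
  "finite (delannoy_paths_NE n m k) \<and>
     int (card (delannoy_paths_NE n m k)) = coeff (delannoy_poly n m) k"
proof (induction n m arbitrary: k rule: delannoy_poly.induct)
  case (1 m)
  have "count_list (replicate m N) NE = 0"
    by (induction m) auto
  then have "delannoy_paths_NE 0 m k = (if k = 0 then {replicate m N} else {})"
    by (auto simp: delannoy_paths_NE_def delannoy_paths_0_left)
  then show ?case by (simp add: coeff_1)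
next
  case (2 n)
  have "count_list (replicate (Suc n) E) NE = 0"
    by (induction n) auto
  then have "delannoy_paths_NE (Suc n) 0 k = (if k = 0 then {replicate (Suc n) E} else {})"
    by (auto simp: delannoy_paths_NE_def delannoy_paths_0_right)
  then show ?case by (simp add: coeff_1)
next
  case (3 n m)
  let ?E = "(#) E ` delannoy_paths_NE n (Suc m) k" and ?N = "(#) N ` delannoy_paths_NE (Suc n) m k"
  let ?NE = "if k = 0 then {} else (#) NE ` delannoy_paths_NE n m (k - 1)"
  have fin: "finite ?E" "finite ?N" "finite ?NE"
    using "3.IH" by auto
  have "card (?E \<union> ?N \<union> ?NE) = card ?E + card ?N + card ?NE"
    using fin by (subst card_Un_disjoint; (subst card_Un_disjoint)?) (auto split: if_splits)
  moreover have "card ?NE = (if k = 0 then 0 else card (delannoy_paths_NE n m (k - 1)))"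
    by (simp add: card_image)
  ultimately show ?case
    using fin "3.IH" unfolding delannoy_paths_NE_Suc_Suc delannoy_poly.simps coeff_add coeff_X_mult
    by (simp add: card_image)
qed

section \<open>The values of the two families\<close>

theorem lemma5p3:
  fixes n m :: nat
  shows
    "(\<exists>!v. is_reduced_value (X 1 2 ^ n * X 2 3 ^ m) v) \<and>
     (\<exists>!v. is_reduced_value ((\<Prod>i = 1..<n. X i (i + 1)) ^ m) v) \<and>
     (reduced_value (X 1 2 ^ n * X 2 3 ^ m) =
       (\<Sum>k = 0..min n m. of_nat ((n + m - k) choose m) * of_nat (m choose k) * [:0, 1:] ^ k)) \<and>
     (reduced_value (X 1 2 ^ n * X 2 3 ^ m) =
       (\<Sum>k = 0..min n m. of_nat (n choose k) * of_nat (m choose k) * (1 + [:0, 1:]) ^ k)) \<and>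
     symmetric_poly (pcompose (reduced_value ((\<Prod>i = 1..<n. X i (i + 1)) ^ m)) ([:0, 1:] - 1)) \<and>
     (\<forall>k. coeff (pcompose (reduced_value ((\<Prod>i = 1..<n. X i (i + 1)) ^ m)) ([:0, 1:] - 1)) k \<ge> 0) \<and>
     (\<forall>k. coeff (reduced_value (X 1 2 ^ n * X 2 3 ^ m)) k =
       int (card {s \<in> delannoy_paths n m. count_list s NE = k}))"
proof -
  have two_step: "X 1 2 ^ n * X 2 3 ^ m =
      Poly_Mapping.single (Poly_Mapping.single (1, 2) n + Poly_Mapping.single (2, 3) m) 1"
    by (simp only: X_power mult_single mult_1_right)
  \<comment> \<open>The empty summand gives the multiset the shape required by \<open>h_polynomial_two_step_path\<close>.\<close>
  have two_step_edges: "edges_of (Poly_Mapping.single (1, 2) n + Poly_Mapping.single (2, 3) m) =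
      replicate_mset n (1, 2) + replicate_mset m (2, 3) + replicate_mset 0 (1, 3)"
    by (simp add: edges_of_add edges_of_single)
  have "admissible 3 (edges_of (Poly_Mapping.single (1, 2) n + Poly_Mapping.single (2, 3) m))"
    unfolding two_step_edges by (auto simp: admissible_def split: if_splits)
  note two_step_value = reduced_value_single[OF this, folded two_step,
      unfolded two_step_edges h_polynomial_two_step_path]
  have adm: "admissible n (path_edges n m)"
    by (auto simp: admissible_def dest: in_path_edges)
  note path_value = reduced_value_single[where M = "\<Sum>i = 1..<n. Poly_Mapping.single (i, i + 1) m",
      unfolded edges_of_path, OF adm, folded path_monomial]
  have path_shifted: "pcompose (reduced_value ((\<Prod>i = 1..<n. X i (i + 1)) ^ m)) ([:0, 1:] - 1) =
      h_polynomial n (path_edges n m)"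
    unfolding path_value(2) by (rule pcompose_translate_back)
  have paths: "coeff (delannoy_poly n m) k = int (card {s \<in> delannoy_paths n m. count_list s NE = k})"
    for k
    using card_delannoy_paths_NE[of n m k] by (simp add: delannoy_paths_NE_def)
  show ?thesis
    unfolding path_shifted two_step_value(2)
  proof (intro conjI allI)
    show "\<exists>!v. is_reduced_value (X 1 2 ^ n * X 2 3 ^ m) v"
      by (rule two_step_value(1))
    show "\<exists>!v. is_reduced_value ((\<Prod>i = 1..<n. X i (i + 1)) ^ m) v"
      by (rule path_value(1))
    show "symmetric_poly (h_polynomial n (path_edges n m))"
      by (rule h_polynomial_path_symmetric)
    show "0 \<le> coeff (h_polynomial n (path_edges n m)) k" for k
      by (rule h_polynomial_nonneg[OF adm])
  qed (rule delannoy_poly_trinomial delannoy_poly_shifted paths)+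
qed

end
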